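(* Let $X$ be a locally pathwise connected Hausdorff space, let $U\subset\mathbb{R}^n$ be an open subset, $n\geq 1$, and let $f:X\times U\to\mathbb{R}^n$ be a continuous map. Suppose that, for each $x\in X$, the map $f_x:U\to\mathbb{R}^n$, $f_x(y)=f(x,y)$, is a differentiable (not necessarily $C^1$) map without critical points. Let $(x_0,y_0)\in X\times U$ and $z_0=f(x_0,y_0)$. Then there exist a neighborhood $V$ of $x_0$ in $X$ and a continuous function $g:V\to U$ such that $f(x,g(x))=z_0$ for each $x\in V$.
   Context: A map from an open subset of $\mathbb{R}^n$ to $\mathbb{R}^n$ is differentiable if it is (Fréchet) differentiable at every point. A critical point of such a map is a point at which the derivative is not invertible (its Jacobian determinant is zero). *)

theory Defs
  imports "HOL-Analysis.Analysis"
begin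

text \<open>This is only meaningful where \<open>h\<close> is differentiable: elsewhere
  \<^const>\<open>frechet_derivative\<close>, and hence \<^const>\<open>jacobian\<close>, is an unspecified value.\<close>

definition critical_point :: "(real ^ 'n \<Rightarrow> real ^ 'n) \<Rightarrow> real ^ 'n \<Rightarrow> bool" where
  "critical_point h y \<longleftrightarrow> \<not> invertible (jacobian h (at y))"

end

theory Submission imports Defs begin

text \<open>
  An everywhere differentiable map \<open>h\<close> with injective derivatives is locally injective, by
  Saint Raymond's argument. If the closed set \<open>H\<close> of bad points were nonempty, the Baire category
  theorem would give a point \<open>q \<in> H\<close> and a constant \<open>c > 0\<close> with
  \<open>c |x - y| \<le> |h x - h y|\<close> for \<open>x \<in> H\<close> and all \<open>y\<close> near \<open>q\<close>. Suppose \<open>z\<close> near \<open>h q\<close> has two preimages near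
  \<open>q\<close>, and take the largest ball about \<open>z\<close> that avoids \<open>h(H)\<close>; it touches \<open>h(H)\<close> at some
  \<open>w = h w'\<close>. Over this ball \<open>h\<close> is a proper local homeomorphism, hence a covering with two
  disjoint sections. Near \<open>w\<close>, differentiability at \<open>w'\<close> makes the segment
  joining the two sections over \<open>u\<close> have its image in a ball about \<open>u\<close> that still avoids \<open>h(H)\<close>,
  so the two sections lie in the same sheet, a contradiction.

  A locally injective map uniformly close to an injective one is again a covering
  over a ball, which yields exactly one solution of \<open>f(x, y) = z\<^sub>0\<close> near \<open>y\<^sub>0\<close> for each \<open>x\<close> near
  \<open>x\<^sub>0\<close>; uniqueness and compactness make it continuous in \<open>x\<close>.
\<close>

section \<open>Covering maps from proper local homeomorphisms\<close>

lemma locally_injective_image_open: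
  fixes f :: "'a::euclidean_space \<Rightarrow> 'a"
  assumes "open P" "continuous_on P f"
    and inj: "\<And>y. y \<in> P \<Longrightarrow> \<exists>e>0. inj_on f (ball y e)"
  shows "open (f ` P)"
proof (subst open_subopen, intro ballI)
  fix z assume "z \<in> f ` P"
  then obtain y where y: "y \<in> P" "z = f y" by blast
  obtain e where e: "e > 0" "inj_on f (ball y e)" using inj y by blast
  have "open (f ` (ball y e \<inter> P))"
    by (intro invariance_of_domain continuous_on_subset[OF assms(2)] inj_on_subset[OF e(2)] open_Int)
       (use assms in auto)
  then show "\<exists>T. open T \<and> z \<in> T \<and> T \<subseteq> f ` P"
    using y e by (intro exI[of _ "f ` (ball y e \<inter> P)"]) auto
qed

text \<open>The frontier condition makes \<open>f\<close> proper over \<open>Q\<close>, and local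
  injectivity makes it a local homeomorphism there by invariance of domain. Its fibres are then
  finite, and since \<open>Q\<close> is connected and meets the image, all of \<open>Q\<close> is
  covered.\<close>

lemma covering_space_bounded_locally_injective:
  fixes f :: "'a::euclidean_space \<Rightarrow> 'a"
  assumes B: "open B" "bounded B" and contf: "continuous_on (closure B) f"
    and Q: "open Q" "connected Q" and front: "\<And>y. y \<in> closure B - B \<Longrightarrow> f y \<notin> Q"
    and inj: "\<And>y. y \<in> B \<Longrightarrow> f y \<in> Q \<Longrightarrow> \<exists>e>0. inj_on f (ball y e)"
    and ne: "B \<inter> f -` Q \<noteq> {}"
  shows "covering_space (B \<inter> f -` Q) f Q"
proof -
  let ?P = "B \<inter> f -` Q"
  have contB: "continuous_on B f" using contf closure_subset continuous_on_subset by blast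
  have openP: "open ?P" using continuous_open_preimage[OF contB B(1) Q(1)] .
  have compB: "compact (closure B)" using B by (simp add: compact_closure)
  have contP: "continuous_on ?P f" using contB continuous_on_subset by blast
  have clo_im: "closed (f ` (closure B - N))" if "open N" for N
  proof -
    have "compact (closure B - N)" using compB that by (rule compact_diff)
    then show ?thesis
      by (meson compact_continuous_image compact_imp_closed contf continuous_on_subset Diff_subset)
  qed
  have surj: "f ` ?P = Q"
  proof -
    have "open (f ` ?P)" using locally_injective_image_open[OF openP contP] inj by blast
    then have "openin (top_of_set Q) (f ` ?P)" by (auto intro: open_subset)
    \<comment> \<open>Frontier points contribute nothing over \<open>Q\<close>, so the image is the
      trace on \<open>Q\<close> of a compact set.\<close>
    moreover have "f ` ?P = Q \<inter> f ` (closure B - {})" using front closure_subset by blast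
    then have "closedin (top_of_set Q) (f ` ?P)" using clo_im[of "{}"]
      by (simp add: closedin_closed_Int)
    ultimately show ?thesis using Q(2) ne connected_clopen by blast
  qed
  have "\<exists>T. z \<in> T \<and> openin (top_of_set Q) T \<and> (\<exists>v. \<Union>v = ?P \<inter> f -` T \<and>
          (\<forall>u \<in> v. openin (top_of_set ?P) u) \<and> pairwise disjnt v \<and>
          (\<forall>u \<in> v. \<exists>q. homeomorphism u T f q))" if z: "z \<in> Q" for z
  proof -
    let ?Z = "closure B \<inter> f -` {z}"
    have ZP: "?Z \<subseteq> ?P" using front z by blast
    have "closed ?Z" using continuous_closed_preimage[OF contf closed_closure, of "{z}"] by simp
    then have compZ: "compact ?Z" using compB
      by (metis closed_Int_compact inf.left_idem inf_commute)
    have finZ: "finite ?Z"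
    proof -
      have "\<not> y islimpt ?Z" if y: "y \<in> ?Z" for y
      proof
        assume l: "y islimpt ?Z"
        obtain e where e: "e > 0" "inj_on f (ball y e)" using inj y ZP by blast
        then obtain y' where "y' \<in> ?Z" "y' \<noteq> y" "dist y' y < e"
          using l by (auto simp: islimpt_approachable)
        then show False using e y by (auto dest!: inj_onD[of f _ y' y] simp: dist_commute)
      qed
      then show ?thesis using finite_not_islimpt_in_compact[OF compZ, of ?Z] by simp
    qed
    \<comment> \<open>The factor 2 makes the balls about distinct fibre points disjoint: their radii
      add up to at most the distance of the centres.\<close>
    have "\<exists>e>0. ball y e \<subseteq> ?P \<and> inj_on f (ball y e) \<and> (\<forall>y'\<in>?Z. y' \<noteq> y \<longrightarrow> 2 * e \<le> dist y y')"
      if y: "y \<in> ?Z" for y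
    proof -
      obtain e1 where e1: "e1 > 0" "inj_on f (ball y e1)" using inj y ZP by blast
      obtain e2 where e2: "e2 > 0" "ball y e2 \<subseteq> ?P" using openP y ZP by (meson open_contains_ball subsetD)
      obtain e3 where e3: "e3 > 0" "\<forall>y'\<in>?Z. y' \<noteq> y \<longrightarrow> e3 \<le> dist y y'"
        using finite_set_avoid[OF finZ] by blast
      let ?e = "min (min e1 e2) (e3/2)"
      have "?e > 0" using e1 e2 e3 by simp
      moreover have "ball y ?e \<subseteq> ?P" using e2(2) by (auto simp: subset_iff)
      moreover have "inj_on f (ball y ?e)" using e1(2) by (rule inj_on_subset) auto
      moreover have "\<forall>y'\<in>?Z. y' \<noteq> y \<longrightarrow> 2 * ?e \<le> dist y y'" using e3(2) by (auto simp: min_def)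
      ultimately show ?thesis by blast
    qed
    then have "\<forall>y\<in>?Z. \<exists>e>0. ball y e \<subseteq> ?P \<and> inj_on f (ball y e) \<and> (\<forall>y'\<in>?Z. y' \<noteq> y \<longrightarrow> 2 * e \<le> dist y y')"
      by blast
    from bchoice[OF this] obtain e where e: "\<And>y. y \<in> ?Z \<Longrightarrow> e y > 0" "\<And>y. y \<in> ?Z \<Longrightarrow> ball y (e y) \<subseteq> ?P"
      "\<And>y. y \<in> ?Z \<Longrightarrow> inj_on f (ball y (e y))"
      "\<And>y y'. y \<in> ?Z \<Longrightarrow> y' \<in> ?Z \<Longrightarrow> y' \<noteq> y \<Longrightarrow> 2 * e y \<le> dist y y'"
      by blast
    define N where "N y = ball y (e y)" for y
    have opN: "open (N y)" for y by (simp add: N_def)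
    have disjN: "N y \<inter> N y' = {}" if "y \<in> ?Z" "y' \<in> ?Z" "y \<noteq> y'" for y y'
    proof -
      have "e y + e y' \<le> dist y y'" using e(4)[of y y'] e(4)[of y' y] that by (simp add: dist_commute)
      then show ?thesis unfolding N_def by (simp add: disjoint_ballI)
    qed
    have imN: "open (f ` N y)" if "y \<in> ?Z" for y
      unfolding N_def using e(2,3)[OF that] contP
      by (intro invariance_of_domain) (auto intro: continuous_on_subset)
    \<comment> \<open>Intersecting the images makes every \<open>N y\<close> reach all of
      \<open>T\<close>; removing the image of the compact remainder leaves no preimage of
      \<open>T\<close> outside the \<open>N y\<close>.\<close>
    define T where "T = Q \<inter> (\<Inter>y\<in>?Z. f ` N y) - f ` (closure B - (\<Union>y\<in>?Z. N y))"
    have "closed (f ` (closure B - (\<Union>y\<in>?Z. N y)))"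
      by (intro clo_im open_UN ballI opN)
    then have opT: "open T" unfolding T_def
      using imN finZ Q by (intro open_Diff open_Int open_INT ballI) auto
    have zT: "z \<in> T" unfolding T_def N_def using z e(1) by force
    define v where "v = (\<lambda>y. N y \<inter> f -` T) ` ?Z"
    have opu: "open (N y \<inter> f -` T)" if "y \<in> ?Z" for y
      using e(2)[OF that] contP opT opN unfolding N_def
      by (meson continuous_on_subset continuous_open_preimage open_ball)
    have "\<Union>v = ?P \<inter> f -` T"
    proof
      show "\<Union>v \<subseteq> ?P \<inter> f -` T" using e(2) by (auto simp: v_def N_def)
      show "?P \<inter> f -` T \<subseteq> \<Union>v"
      proof
        fix y assume y: "y \<in> ?P \<inter> f -` T"
        then have "f y \<notin> f ` (closure B - (\<Union>y\<in>?Z. N y))" by (simp add: T_def)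
        moreover have "y \<in> closure B" using y closure_subset by auto
        ultimately have "y \<in> (\<Union>y\<in>?Z. N y)" by blast
        then show "y \<in> \<Union>v" using y by (auto simp: v_def)
      qed
    qed
    moreover have "openin (top_of_set ?P) u" if "u \<in> v" for u
    proof -
      obtain y where y: "y \<in> ?Z" "u = N y \<inter> f -` T"
        using \<open>u \<in> v\<close> unfolding v_def by auto
      show ?thesis using opu[OF y(1)] e(2)[OF y(1)] unfolding y(2) N_def by (intro open_subset) blast+
    qed
    moreover have "pairwise disjnt v" unfolding v_def pairwise_def disjnt_def using disjN by blast
    moreover have "\<exists>q. homeomorphism u T f q" if "u \<in> v" for u
    proof -
      obtain y where y: "y \<in> ?Z" "u = N y \<inter> f -` T" using \<open>u \<in> v\<close> unfolding v_def by auto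
      have "T \<subseteq> f ` N y" using y(1) unfolding T_def by blast
      then have "f ` u = T" unfolding y(2) by auto
      moreover have "inj_on f u" using e(3)[OF y(1)] y(2) by (auto simp: N_def intro: inj_on_subset)
      moreover have "continuous_on u f" using contP y e(2)[OF y(1)] unfolding N_def
        by (metis continuous_on_subset inf.coboundedI1)
      moreover have "open u" using opu y by simp
      ultimately show ?thesis by (metis invariance_of_domain_homeomorphism order_refl)
    qed
    ultimately show ?thesis using opT zT
      by (intro exI[of _ T] conjI exI[of _ v]) (auto simp: T_def intro: open_subset)
  qed
  then show ?thesis using contP surj unfolding covering_space_def by blast
qed

section \<open>Sections and sheets over convex sets\<close>

lemma covering_space_convex_section:
  fixes p :: "'a::real_normed_vector \<Rightarrow> 'b::real_normed_vector"
  assumes "covering_space P p Q" "convex Q" "y \<in> P"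
  obtains g where "continuous_on Q g" "g ` Q \<subseteq> P" "g (p y) = y" "\<And>z. z \<in> Q \<Longrightarrow> p (g z) = z"
proof -
  have "p y \<in> Q" using assms covering_space_imp_surjective by blast
  then show ?thesis
    using covering_space_lift_strong[OF assms(1,3), of "p y" Q "\<lambda>x. x"] assms(2) that
    by (metis convex_imp_simply_connected convex_imp_locally_path_connected continuous_on_id
        funcset_id funcset_image id_def)
qed

text \<open>If \<open>g\<close> is the section through \<open>a\<close>, then
  \<open>g \<circ> p\<close> and the identity are two lifts of \<open>p\<close> on \<open>C\<close>
  that agree at \<open>a\<close>. Uniqueness of lifts on a connected set gives
  \<open>b = g (p b) = g (p a) = a\<close>.\<close>

lemma covering_space_convex_inj_on_connected:
  fixes p :: "'a::real_normed_vector \<Rightarrow> 'b::real_normed_vector"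
  assumes cov: "covering_space P p Q" and "convex Q" and C: "connected C" "C \<subseteq> P"
  shows "inj_on p C"
proof
  fix a b assume ab: "a \<in> C" "b \<in> C" "p a = p b"
  then obtain g where g: "continuous_on Q g" "g ` Q \<subseteq> P" "g (p a) = a" "\<And>z. z \<in> Q \<Longrightarrow> p (g z) = z"
    using covering_space_convex_section[OF cov \<open>convex Q\<close>, of a] C by blast
  have pC: "p ` C \<subseteq> Q" using covering_space_imp_surjective[OF cov] C by blast
  have contp: "continuous_on C p" using covering_space_imp_continuous[OF cov] C continuous_on_subset by blast
  have "(g \<circ> p) b = id b"
  proof (rule covering_space_lift_unique[OF cov, of "g \<circ> p" a id C p])
    show "continuous_on C (g \<circ> p)"
      using contp g(1) pC continuous_on_compose continuous_on_subset by blast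
  qed (use g(2-4) C pC contp ab in \<open>auto simp: image_subset_iff\<close>)
  then show "a = b" using g(3) ab(3) by simp
qed

section \<open>Local injectivity from injective derivatives\<close>

text \<open>This is the geometric half of the argument: a uniform expansion estimate along
  \<open>H\<close> near \<open>q\<close> makes \<open>q\<close> a good point after all. The Baire
  half, in the next theorem, supplies such a \<open>q\<close>.\<close>

lemma inj_on_near_expansion_point:
  fixes h :: "'a::euclidean_space \<Rightarrow> 'a"
  assumes U: "open U" and H: "closedin (top_of_set U) H"
    and der: "\<And>y. y \<in> U \<Longrightarrow> h differentiable (at y)"
    and inj: "\<And>y. y \<in> U - H \<Longrightarrow> \<exists>e>0. inj_on h (ball y e)"
    and q: "q \<in> H" and r: "r > 0" "cball q r \<subseteq> U" and c: "c > 0"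
    and expand: "\<And>x y. x \<in> H \<inter> cball q r \<Longrightarrow> y \<in> cball q r \<Longrightarrow> c * dist x y \<le> dist (h x) (h y)"
  shows "\<exists>e>0. inj_on h (ball q e)"
proof -
  have conth: "continuous_on U h"
    using der U by (simp add: continuous_at_imp_continuous_on differentiable_imp_continuous_within)
  then have contc: "continuous_on (cball q r) h" using r continuous_on_subset by blast
  \<comment> \<open>The bound \<open>c * r / 2\<close> is half of what \<open>expand\<close>
    guarantees at \<open>q\<close> on the sphere of radius \<open>r\<close>, so that this sphere is
    mapped outside \<open>?Q\<close> below.\<close>
  have key: "y1 = y2" if y: "y1 \<in> ball q r" "y2 \<in> ball q r" "h y1 = z" "h y2 = z"
    and z: "dist z (h q) < c * r / 2" for y1 y2 z
  proof (rule ccontr)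
    assume ne: "y1 \<noteq> y2"
    let ?F = "h ` (H \<inter> cball q r)"
    have "compact (H \<inter> cball q r)"
    proof -
      obtain K where "closed K" "H = U \<inter> K" using H by (auto simp: closedin_closed)
      then have "H \<inter> cball q r = K \<inter> cball q r" using r by blast
      then show ?thesis using \<open>closed K\<close> by (simp add: closed_Int_compact)
    qed
    then have "compact ?F" using contc
      by (meson compact_continuous_image continuous_on_subset inf_le2)
    moreover have qF: "h q \<in> ?F" using q r by auto
    ultimately obtain w where w: "w \<in> ?F" "\<And>w'. w' \<in> ?F \<Longrightarrow> dist z w \<le> dist z w'"
      using distance_attains_inf[of ?F z] by (metis compact_imp_closed empty_iff)
    obtain w' where w': "w' \<in> H" "w' \<in> cball q r" "w = h w'" using w(1) by blast
    let ?\<rho> = "dist z w"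
    have \<rho>z: "?\<rho> \<le> dist z (h q)" using w(2)[OF qF] .
    \<comment> \<open>If \<open>z\<close> itself were in \<open>?F\<close>, expansion at
      \<open>w'\<close> would force both preimages to equal \<open>w'\<close>.\<close>
    have "?\<rho> > 0"
    proof (rule ccontr)
      assume "\<not> ?thesis"
      then have "h w' = h y1" "h w' = h y2" using w' y by auto
      then have "c * dist w' y1 \<le> 0" "c * dist w' y2 \<le> 0"
        using expand[of w' y1] expand[of w' y2] w' y by auto
      then show False using ne c by (auto simp: mult_le_0_iff)
    qed
    let ?Q = "ball z ?\<rho>"
    let ?P = "ball q r \<inter> h -` ?Q"
    have cov: "covering_space ?P h ?Q"
    proof (rule covering_space_bounded_locally_injective)
      show "continuous_on (closure (ball q r)) h" using contc r by simp
      show "h y \<notin> ?Q" if "y \<in> closure (ball q r) - ball q r" for y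
      proof
        assume "h y \<in> ?Q"
        then have "dist z (h y) < c * r / 2" using \<rho>z z by simp
        then have "dist (h q) (h y) < c * r"
          using z dist_triangle3[of "h q" "h y" z] by simp
        moreover have "dist q y = r" "y \<in> cball q r" using that r by auto
        then have "c * r \<le> dist (h q) (h y)" using expand[of q y] q r by auto
        ultimately show False by simp
      qed
      show "\<exists>e>0. inj_on h (ball y e)" if "y \<in> ball q r" "h y \<in> ?Q" for y
      proof -
        \<comment> \<open>Otherwise \<open>h y\<close> would be a point of \<open>?F\<close> closer
          to \<open>z\<close> than the nearest point \<open>w\<close>.\<close>
        have "y \<notin> H" using w(2)[of "h y"] that by auto
        then show ?thesis using that r inj by (meson DiffI ball_subset_cball subsetD)
      qed
      show "?P \<noteq> {}" using y \<open>?\<rho> > 0\<close> by auto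
    qed auto
    have "y1 \<in> ?P" "y2 \<in> ?P" using y \<open>?\<rho> > 0\<close> by auto
    then obtain g1 g2 where
      g1: "continuous_on ?Q g1" "g1 ` ?Q \<subseteq> ?P" "g1 z = y1" "\<And>u. u \<in> ?Q \<Longrightarrow> h (g1 u) = u" and
      g2: "continuous_on ?Q g2" "g2 ` ?Q \<subseteq> ?P" "g2 z = y2" "\<And>u. u \<in> ?Q \<Longrightarrow> h (g2 u) = u"
      using covering_space_convex_section[OF cov convex_ball] y(3,4) by metis
    \<comment> \<open>If the sections met, the union of their images would be connected, so
      \<open>h\<close> would be injective on it, against \<open>y1\<close> and
      \<open>y2\<close>.\<close>
    have g12: "g1 u \<noteq> g2 u" if "u \<in> ?Q" for u
    proof
      assume "g1 u = g2 u"
      then have "g1 ` ?Q \<inter> g2 ` ?Q \<noteq> {}" using that by blast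
      then have "connected (g1 ` ?Q \<union> g2 ` ?Q)"
        using g1(1) g2(1) by (intro connected_Un connected_continuous_image) auto
      then have "inj_on h (g1 ` ?Q \<union> g2 ` ?Q)"
        using covering_space_convex_inj_on_connected[OF cov convex_ball] g1 g2 by simp
      then show False using g1 g2 ne y \<open>?\<rho> > 0\<close> by (auto dest!: inj_onD[of h _ y1 y2])
    qed
    have "w' \<in> U" using w' r by blast
    then obtain A where A: "(h has_derivative A) (at w')" using der differentiable_def by blast
    then have linA: "linear A" by (rule has_derivative_linear)
    \<comment> \<open>At distance at most \<open>\<tau> * ?\<rho> / c\<close> from
      \<open>w'\<close>, the factor \<open>c/4\<close> gives an error of at most
      \<open>\<tau> * ?\<rho> / 4\<close>; two such errors stay below
      \<open>\<tau> * ?\<rho>\<close>.\<close>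
    obtain d where d: "d > 0" "\<And>y. norm (y - w') < d \<Longrightarrow> norm (h y - h w' - A (y - w')) \<le> c/4 * norm (y - w')"
      using A c unfolding has_derivative_at_alt by (meson divide_pos_pos zero_less_numeral)
    \<comment> \<open>The bound by 1 keeps \<open>u\<close> on the segment from \<open>w\<close> to
      \<open>z\<close>; the other bound brings the preimages of \<open>u\<close> in
      \<open>?P\<close> within distance \<open>d\<close> of \<open>w'\<close>.\<close>
    define \<tau> where "\<tau> = min 1 (d * c / (2 * ?\<rho>))"
    have \<tau>: "0 < \<tau>" "\<tau> \<le> 1" using d c \<open>?\<rho> > 0\<close> by (auto simp: \<tau>_def)
    have "\<tau> * ?\<rho> \<le> d * c / (2 * ?\<rho>) * ?\<rho>"
      using \<open>?\<rho> > 0\<close> by (intro mult_right_mono) (auto simp: \<tau>_def)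
    also have "\<dots> = d * c / 2" using \<open>?\<rho> > 0\<close> by simp
    also have "\<dots> < d * c" using c d(1) by simp
    finally have \<tau>d: "\<tau> * ?\<rho> / c < d" using c by (simp add: pos_divide_less_eq)
    \<comment> \<open>The ball of radius \<open>\<tau> * ?\<rho>\<close> about \<open>u\<close> lies
      inside \<open>?Q\<close> and touches its boundary at \<open>w\<close>.\<close>
    define u where "u = w + \<tau> *\<^sub>R (z - w)"
    have uw: "norm (u - w) = \<tau> * ?\<rho>" using \<tau> by (simp add: u_def dist_norm)
    have "z - u = (1 - \<tau>) *\<^sub>R (z - w)" by (simp add: u_def algebra_simps)
    then have "dist z u = (1 - \<tau>) * ?\<rho>" using \<tau> by (simp add: dist_norm)
    then have zu: "dist z u = ?\<rho> - \<tau> * ?\<rho>" by (simp add: left_diff_distrib)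
    have \<tau>\<rho>: "0 < \<tau> * ?\<rho>" using \<tau>(1) \<open>?\<rho> > 0\<close> by (rule mult_pos_pos)
    have uQ: "u \<in> ?Q" using zu \<tau>\<rho> by simp
    \<comment> \<open>Expansion at \<open>w'\<close> confines the preimages of \<open>u\<close>;
      differentiability at \<open>w'\<close> then shows that the affine approximation of
      \<open>h\<close> sends them close to \<open>u\<close>.\<close>
    have near: "norm (g - w') \<le> \<tau> * ?\<rho> / c" "norm (w + A (g - w') - u) \<le> \<tau> * ?\<rho> / 4"
      if "g \<in> ?P" "h g = u" for g
    proof -
      have "c * dist w' g \<le> dist w u" using expand[of w' g] w' that by simp
      then show 1: "norm (g - w') \<le> \<tau> * ?\<rho> / c"
        using c uw by (simp add: dist_norm norm_minus_commute field_simps)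
      then have "norm (h g - h w' - A (g - w')) \<le> c/4 * norm (g - w')" using d(2) \<tau>d by simp
      also have "\<dots> \<le> c/4 * (\<tau> * ?\<rho> / c)" using 1 c by (intro mult_left_mono) auto
      finally have "norm (u - w - A (g - w')) \<le> \<tau> * ?\<rho> / 4" using that w' c by simp
      then show "norm (w + A (g - w') - u) \<le> \<tau> * ?\<rho> / 4"
        by (metis (no_types, lifting) diff_diff_eq norm_minus_commute)
    qed
    have P12: "g1 u \<in> ?P" "g2 u \<in> ?P" "h (g1 u) = u" "h (g2 u) = u"
      using g1(2,4) g2(2,4) uQ by blast+
    \<comment> \<open>Both bounds in \<open>near\<close> describe convex sets, so they pass from the
      endpoints to the whole segment. Adding the approximation error keeps \<open>h\<close> within
      \<open>\<tau> * ?\<rho>\<close> of \<open>u\<close>, hence in \<open>?Q\<close>.\<close>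
    have "closed_segment (g1 u) (g2 u) \<subseteq> ?P"
    proof
      fix y assume seg: "y \<in> closed_segment (g1 u) (g2 u)"
      have "convex (cball w' (\<tau> * ?\<rho> / c))" by simp
      moreover have "g1 u \<in> cball w' (\<tau> * ?\<rho> / c)" "g2 u \<in> cball w' (\<tau> * ?\<rho> / c)"
        using near(1)[OF P12(1,3)] near(1)[OF P12(2,4)] by (auto simp: dist_norm norm_minus_commute)
      ultimately have "y \<in> cball w' (\<tau> * ?\<rho> / c)"
        using seg closed_segment_subset by (meson subsetD)
      then have yc: "norm (y - w') \<le> \<tau> * ?\<rho> / c" by (simp add: dist_norm norm_minus_commute)
      let ?L = "{y. norm (w + A (y - w') - u) \<le> \<tau> * ?\<rho> / 4}"
      have "?L = A -` cball (u - w + A w') (\<tau> * ?\<rho> / 4)"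
        by (auto simp: linear_diff[OF linA] dist_norm norm_minus_commute algebra_simps)
      then have "convex ?L" using convex_linear_vimage[OF linA convex_cball] by simp
      moreover have "g1 u \<in> ?L" "g2 u \<in> ?L" using near(2)[OF P12(1,3)] near(2)[OF P12(2,4)] by simp_all
      ultimately have "y \<in> ?L" using seg closed_segment_subset[of "g1 u" ?L "g2 u"] by (meson subsetD)
      then have yL: "norm (w + A (y - w') - u) \<le> \<tau> * ?\<rho> / 4" by simp
      have "norm (h y - w - A (y - w')) \<le> c/4 * norm (y - w')" using d(2) yc \<tau>d w' by simp
      also have "\<dots> \<le> c/4 * (\<tau> * ?\<rho> / c)" using yc c by (intro mult_left_mono) auto
      finally have "norm (h y - w - A (y - w')) \<le> \<tau> * ?\<rho> / 4" using c by simp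
      then have "norm (h y - u) \<le> \<tau> * ?\<rho> / 4 + \<tau> * ?\<rho> / 4"
        using yL norm_triangle_ineq[of "h y - w - A (y - w')" "w + A (y - w') - u"] by simp
      also have "\<dots> < \<tau> * ?\<rho>" using \<tau>\<rho> by simp
      finally have "dist z (h y) < ?\<rho>"
        using zu dist_triangle[of z "h y" u] by (simp add: dist_norm norm_minus_commute)
      moreover have "y \<in> ball q r" using seg P12(1,2) closed_segment_subset[OF _ _ convex_ball]
        by (meson IntD1 subsetD)
      ultimately show "y \<in> ?P" by simp
    qed
    then have "inj_on h (closed_segment (g1 u) (g2 u))"
      by (intro covering_space_convex_inj_on_connected[OF cov convex_ball] connected_segment)
    then show False using P12 g12[OF uQ] by (auto dest!: inj_onD[of h _ "g1 u" "g2 u"])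
  qed
  have "isCont h q" using conth U q r by (meson centre_in_cball continuous_on_eq_continuous_at less_imp_le subsetD)
  then obtain e where e: "e > 0" "\<And>y. dist y q < e \<Longrightarrow> dist (h y) (h q) < c * r / 2"
    using c r unfolding continuous_at_eps_delta by (metis half_gt_zero mult_pos_pos)
  have "inj_on h (ball q (min e r))"
  proof (rule inj_onI)
    fix y1 y2 assume y: "y1 \<in> ball q (min e r)" "y2 \<in> ball q (min e r)" "h y1 = h y2"
    show "y1 = y2"
    proof (rule key)
      show "dist (h y1) (h q) < c * r / 2" using y by (intro e(2)) (simp add: dist_commute)
    qed (use y in auto)
  qed
  then show ?thesis using e r by (intro exI[of _ "min e r"]) auto
qed

text \<open>An injective derivative gives an expansion bound at each bad point, with constants
  depending on the point. The Baire category theorem makes them uniform on a relatively open piece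
  of the bad set, where \<open>inj_on_near_expansion_point\<close> applies.\<close>

theorem locally_injective_if_injective_derivative:
  fixes h :: "'a::euclidean_space \<Rightarrow> 'a"
  assumes U: "open U" and der: "\<And>y. y \<in> U \<Longrightarrow> \<exists>A. (h has_derivative A) (at y) \<and> inj A"
    and y0: "y0 \<in> U"
  shows "\<exists>e>0. inj_on h (ball y0 e)"
proof (rule ccontr)
  assume bad: "\<not> ?thesis"
  have diff: "h differentiable (at y)" if "y \<in> U" for y
    using der[OF that] differentiable_def by blast
  then have conth: "continuous_on U h"
    using U by (simp add: continuous_at_imp_continuous_on differentiable_imp_continuous_within)
  define G where "G = {y. \<exists>e>0. inj_on h (ball y e)}"
  define H where "H = U - G"
  have "open G"
  proof (subst open_subopen, intro ballI)
    fix y assume "y \<in> G"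
    then obtain e where e: "e > 0" "inj_on h (ball y e)" by (auto simp: G_def)
    have "ball y e \<subseteq> G"
    proof
      fix x assume "x \<in> ball y e"
      then obtain d where "d > 0" "ball x d \<subseteq> ball y e"
        using open_contains_ball[of "ball y e"] by blast
      then show "x \<in> G" using e(2) inj_on_subset unfolding G_def by blast
    qed
    then show "\<exists>T. open T \<and> y \<in> T \<and> T \<subseteq> G" using e(1) by (intro exI[of _ "ball y e"]) auto
  qed
  then have cloH: "closedin (top_of_set U) H"
    unfolding H_def by (metis Diff_eq closed_Compl closedin_closed_Int)
  obtain r0 where r0: "r0 > 0" "cball y0 r0 \<subseteq> U" using U y0 by (meson open_contains_cball)
  have y0H: "y0 \<in> H" using y0 bad by (simp add: H_def G_def)
  \<comment> \<open>\<open>H\<close> is closed only relative to \<open>U\<close>, whereas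
    \<open>S\<close> is closed in the whole space and so completely metrizable; it stays inside
    \<open>H\<close> because \<open>cball y0 r0\<close> lies in \<open>U\<close>.\<close>
  define S where "S = closure (H \<inter> ball y0 r0)"
  have SH: "S \<subseteq> H"
  proof -
    obtain K where K: "closed K" "H = U \<inter> K" using cloH by (auto simp: closedin_closed)
    have "S \<subseteq> closure (K \<inter> cball y0 r0)" unfolding S_def K(2) by (rule closure_mono) auto
    also have "\<dots> = K \<inter> cball y0 r0" using K(1) by (simp add: closed_Int)
    finally show ?thesis using K r0 by blast
  qed
  \<comment> \<open>A single index bounds both the radius and the expansion constant, so countably
    many sets exhaust \<open>S\<close>.\<close>
  define E where "E n = {x \<in> S. \<forall>y\<in>U. dist x y < inverse (Suc n) \<longrightarrow> inverse (Suc n) * dist x y \<le> dist (h x) (h y)}"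
    for n :: nat
  have SE: "S \<subseteq> (\<Union>n. E n)"
  proof
    fix x assume x: "x \<in> S"
    then obtain A where A: "(h has_derivative A) (at x)" "inj A" using der SH by (auto simp: H_def)
    obtain b where b: "b > 0" "\<And>v. b * norm v \<le> norm (A v)"
      using linear_inj_bounded_below_pos[OF has_derivative_linear[OF A(1)] A(2)] by blast
    \<comment> \<open>An error of \<open>b/2\<close> leaves half of the lower bound \<open>b\<close>
      of the derivative.\<close>
    obtain d where d: "d > 0" "\<And>y. norm (y - x) < d \<Longrightarrow> norm (h y - h x - A (y - x)) \<le> b/2 * norm (y - x)"
      using A(1) b unfolding has_derivative_at_alt by (meson half_gt_zero)
    obtain n where n: "inverse (Suc n) < min d (b/2)" using reals_Archimedean[of "min d (b/2)"] b d by auto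
    have "inverse (Suc n) * dist x y \<le> dist (h x) (h y)" if "dist x y < inverse (Suc n)" for y
    proof -
      have "norm (h y - h x - A (y - x)) \<le> b/2 * norm (y - x)"
        using d(2)[of y] that n by (simp add: dist_norm norm_minus_commute)
      moreover have "b * norm (y - x) \<le> norm (A (y - x))" by (rule b)
      moreover have "norm (A (y - x)) \<le> norm (h y - h x) + norm (h y - h x - A (y - x))"
        using norm_triangle_ineq4[of "h y - h x" "h y - h x - A (y - x)"] by simp
      ultimately have "b/2 * dist x y \<le> dist (h x) (h y)" by (simp add: dist_norm norm_minus_commute)
      moreover have "inverse (Suc n) * dist x y \<le> b/2 * dist x y"
        using n by (intro mult_right_mono) auto
      ultimately show ?thesis by simp
    qed
    then show "x \<in> (\<Union>n. E n)" using x by (auto simp: E_def)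
  qed
  have cloE: "closedin (top_of_set S) (E n)" for n
  proof -
    \<comment> \<open>For fixed \<open>y\<close> the premise is an open condition on
      \<open>x\<close> and the conclusion a closed one, so the implication defines a union of two
      closed sets.\<close>
    have *: "closedin (top_of_set S) {x \<in> S. dist x y < inverse (Suc n) \<longrightarrow> inverse (Suc n) * dist x y \<le> dist (h x) (h y)}" (is "closedin _ ?A")
      if "y \<in> U" for y
    proof -
      have "continuous_on S h" using conth SH H_def continuous_on_subset by blast
      then have "closedin (top_of_set S) (S \<inter> (\<lambda>x. dist (h x) (h y) - inverse (Suc n) * dist x y) -` {0..})"
        by (intro continuous_closedin_preimage continuous_intros) auto
      moreover have "closedin (top_of_set S) (S \<inter> (\<lambda>x. dist x y) -` {inverse (Suc n)..})"
        by (intro continuous_closedin_preimage continuous_intros closed_atLeast)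
      moreover have "?A = (S \<inter> (\<lambda>x. dist x y) -` {inverse (Suc n)..}) \<union>
          (S \<inter> (\<lambda>x. dist (h x) (h y) - inverse (Suc n) * dist x y) -` {0..})" by auto
      ultimately show ?thesis by (metis closedin_Un)
    qed
    have "E n = (\<Inter>y\<in>U. {x \<in> S. dist x y < inverse (Suc n) \<longrightarrow> inverse (Suc n) * dist x y \<le> dist (h x) (h y)})"
      using y0 by (auto simp: E_def)
    then show ?thesis using * y0 by (metis (mono_tags, lifting) closedin_INT empty_iff)
  qed
  have "\<exists>n. (top_of_set S) interior_of (E n) \<noteq> {}"
  proof (rule ccontr)
    assume "\<not> ?thesis"
    moreover have "completely_metrizable_space (top_of_set S)"
      by (intro completely_metrizable_space_closedin completely_metrizable_space_euclidean)
         (simp add: S_def)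
    ultimately have "(top_of_set S) interior_of (\<Union>(range E)) = {}"
      using cloE by (intro Baire_category_alt) auto
    moreover have "\<Union>(range E) = S" using SE by (auto simp: E_def)
    ultimately have "S = {}" by (metis interior_of_topspace topspace_euclidean_subtopology)
    then show False using y0H r0 closure_subset unfolding S_def by fastforce
  qed
  then obtain n x T where T: "openin (top_of_set S) T" "x \<in> T" "T \<subseteq> E n"
    by (auto simp: interior_of_def)
  then obtain W where W: "open W" "T = S \<inter> W" by (auto simp: openin_open)
  \<comment> \<open>An open set that meets the closure \<open>S\<close> meets the original set, so
    \<open>q\<close> can be taken in the open ball, leaving room for a smaller ball around
    it.\<close>
  then have "H \<inter> ball y0 r0 \<inter> W \<noteq> {}"
    using T(2) open_Int_closure_eq_empty[of W "H \<inter> ball y0 r0"] unfolding S_def by blast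
  then obtain q where q: "q \<in> H" "q \<in> ball y0 r0 \<inter> W" by blast
  obtain d where d: "d > 0" "cball q d \<subseteq> ball y0 r0 \<inter> W"
    using q(2) W(1) by (meson open_Int open_ball open_contains_cball)
  \<comment> \<open>The third ensures that any two points of \<open>cball q r\<close>, being at most
    \<open>2 * r\<close> apart, are within the range of the estimate in \<open>E n\<close>.\<close>
  define r where "r = min d (inverse (Suc n) / 3)"
  have r: "r > 0" "cball q r \<subseteq> ball y0 r0 \<inter> W" using d by (auto simp: r_def)
  have "\<exists>e>0. inj_on h (ball q e)"
  proof (rule inj_on_near_expansion_point[OF U cloH diff])
    show "\<exists>e>0. inj_on h (ball y e)" if "y \<in> U - H" for y using that by (auto simp: H_def G_def)
    show "cball q r \<subseteq> U" using r r0 ball_subset_cball by blast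
    show "inverse (Suc n) * dist x y \<le> dist (h x) (h y)"
      if "x \<in> H \<inter> cball q r" "y \<in> cball q r" for x y
    proof -
      have "x \<in> H \<inter> ball y0 r0" "x \<in> W" using that r by auto
      then have xE: "x \<in> E n" using T(3) W(2) closure_subset unfolding S_def by blast
      have yU: "y \<in> U" using that r r0 ball_subset_cball by blast
      have "dist x y \<le> 2 * r" using that dist_triangle3[of x y q] by simp
      moreover have "r \<le> inverse (Suc n) / 3" "0 < inverse (real (Suc n))" by (simp_all add: r_def)
      ultimately have "dist x y < inverse (Suc n)" by linarith
      then show ?thesis using xE yU by (simp add: E_def)
    qed
  qed (use q r in auto)
  then show False using q by (simp add: H_def G_def)
qed

section \<open>Perturbation of the parameter\<close>

text \<open>The tube lemma applies to the open set of points where \<open>f\<close> differs by less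
  than \<open>e\<close> from its value at parameter \<open>x1\<close>, since this set contains
  \<open>{x1} \<times> K\<close>.\<close>

lemma eventually_uniformly_close_on_compact:
  fixes f :: "'a \<times> 'b::topological_space \<Rightarrow> 'c::real_normed_vector"
  assumes f: "continuous_map (prod_topology X (top_of_set U)) euclidean f"
    and K: "compact K" "K \<subseteq> U" and x1: "x1 \<in> topspace X" and "e > 0"
  obtains V where "openin X V" "x1 \<in> V" "\<And>x y. x \<in> V \<Longrightarrow> y \<in> K \<Longrightarrow> norm (f (x, y) - f (x1, y)) < e"
proof -
  let ?XU = "prod_topology X (top_of_set U)"
  have "continuous_map ?XU ?XU (\<lambda>p. (x1, snd p))"
    using x1 continuous_map_snd by (auto simp: continuous_map_pairwise o_def)
  then have "continuous_map ?XU euclidean (f \<circ> (\<lambda>p. (x1, snd p)))"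
    using f by (rule continuous_map_compose)
  then have "continuous_map ?XU euclidean (\<lambda>p. norm (f p - f (x1, snd p)))"
    using f by (intro continuous_map_norm continuous_map_diff) (auto simp: o_def)
  then have "openin ?XU {p \<in> topspace ?XU. norm (f p - f (x1, snd p)) \<in> {..<e}}" (is "openin _ ?W")
    by (rule openin_continuous_map_preimage) auto
  moreover have "compactin (top_of_set U) K" using K by (simp add: compactin_subtopology)
  moreover have "{x1} \<times> K \<subseteq> ?W" using x1 K \<open>e > 0\<close> by auto
  ultimately obtain V Y where "openin X V" "x1 \<in> V" "K \<subseteq> Y" "V \<times> Y \<subseteq> ?W"
    using tube_lemma_right[of X "top_of_set U" ?W K x1] x1 by blast
  then show ?thesis using that[of V] by force
qed

text \<open>Each passage between \<open>h\<close> and \<open>k\<close> costs \<open>R\<close>,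
  whence the radii \<open>4 * R\<close>, \<open>3 * R\<close>, \<open>2 * R\<close>. Injectivity
  keeps \<open>h\<close> at distance at least \<open>4 * R\<close> from \<open>h y0\<close> on the
  sphere, so \<open>k\<close> is a covering over the ball of radius \<open>3 * R\<close>, which
  gives existence. The \<open>h\<close>-preimage of the ball of radius \<open>2 * R\<close> is
  connected and \<open>k\<close> maps it into that larger ball, which gives uniqueness.\<close>

lemma unique_preimage_perturbation:
  fixes h k :: "'a::euclidean_space \<Rightarrow> 'a"
  assumes r: "r > 0" and conth: "continuous_on (cball y0 r) h" and injh: "inj_on h (cball y0 r)"
    and contk: "continuous_on (cball y0 r) k"
    and injk: "\<And>y. y \<in> ball y0 r \<Longrightarrow> \<exists>e>0. inj_on k (ball y e)"
    and R: "R > 0" "ball (h y0) (4 * R) \<subseteq> h ` ball y0 r"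
    and close: "\<And>y. y \<in> cball y0 r \<Longrightarrow> norm (k y - h y) < R"
  shows "\<exists>!y. y \<in> cball y0 r \<and> k y = h y0"
proof -
  let ?z = "h y0" and ?B = "ball y0 r"
  let ?Q = "ball ?z (3 * R)"
  let ?P = "?B \<inter> k -` ?Q"
  have outer: "k y \<notin> ?Q" if "y \<in> cball y0 r - ?B" for y
  proof
    assume "k y \<in> ?Q"
    then have "dist ?z (h y) < 4 * R"
      using close[of y] that dist_triangle[of ?z "h y" "k y"] by (simp add: dist_norm)
    then obtain y' where "y' \<in> ?B" "h y = h y'" using R(2) by (auto simp: subset_iff)
    then show False using that injh by (auto dest!: inj_onD[of h _ y y'])
  qed
  have inner: "y \<in> ?B" if "y \<in> cball y0 r" "k y = ?z" for y
    using outer[of y] that R(1) by (metis DiffI centre_in_ball zero_less_mult_iff zero_less_numeral)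
  have y0P: "y0 \<in> ?P" using close[of y0] r R(1) by (simp add: dist_norm norm_minus_commute)
  have cov: "covering_space ?P k ?Q"
  proof (rule covering_space_bounded_locally_injective)
    show "k y \<notin> ?Q" if "y \<in> closure ?B - ?B" for y using that outer r by simp
    show "?P \<noteq> {}" using y0P by blast
  qed (use contk r injk in auto)
  obtain g where g: "g ` ?Q \<subseteq> ?P" "\<And>u. u \<in> ?Q \<Longrightarrow> k (g u) = u"
    using covering_space_convex_section[OF cov convex_ball y0P] by metis
  have "?z \<in> ?Q" using R by simp
  then have "g ?z \<in> ?P" and kg: "k (g ?z) = ?z" using g by blast+
  then have ex: "g ?z \<in> cball y0 r" by simp
  let ?C = "?B \<inter> h -` ball ?z (2 * R)"
  have "connected ?C"
  proof -
    obtain h' where h': "homeomorphism ?B (h ` ?B) h h'"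
      using invariance_of_domain_homeomorphism[of ?B h] conth injh ball_subset_cball
      by (metis continuous_on_subset inj_on_subset open_ball order_refl)
    have sub: "ball ?z (2 * R) \<subseteq> h ` ?B"
      using R subset_ball[of "2 * R" "4 * R" ?z] by simp
    have "?C = h' ` ball ?z (2 * R)"
    proof
      show "?C \<subseteq> h' ` ball ?z (2 * R)" using homeomorphism_apply1[OF h'] by force
      show "h' ` ball ?z (2 * R) \<subseteq> ?C"
        using homeomorphism_apply2[OF h'] homeomorphism_image2[OF h'] sub by force
    qed
    then show ?thesis
      using homeomorphism_cont2[OF h'] sub by (metis connected_ball connected_continuous_image continuous_on_subset)
  qed
  moreover have "?C \<subseteq> ?P"
  proof
    fix y assume y: "y \<in> ?C"
    then show "y \<in> ?P" using close[of y] dist_triangle[of ?z "k y" "h y"]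
      by (simp add: dist_norm norm_minus_commute)
  qed
  ultimately have injC: "inj_on k ?C" by (rule covering_space_convex_inj_on_connected[OF cov convex_ball])
  \<comment> \<open>All solutions lie in the connected set \<open>?C\<close>, hence in a single sheet of the covering.\<close>
  have inC: "y \<in> ?C" if "y \<in> cball y0 r" "k y = ?z" for y
    using close[of y] inner[of y] that R(1) by (simp add: dist_norm)
  show "\<exists>!y. y \<in> cball y0 r \<and> k y = ?z"
    using ex kg inC injC by (intro ex1I[of _ "g ?z"]) (auto simp: inj_on_def)
qed

section \<open>Existence and continuity of the implicit function\<close>

theorem corollary4p2:
  fixes X :: "'a topology" and U :: "(real ^ 'n) set"
    and f :: "'a \<times> (real ^ 'n) \<Rightarrow> real ^ 'n"
    and x\<^sub>0 :: 'a and y\<^sub>0 z\<^sub>0 :: "real ^ 'n"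
  assumes "locally_path_connected_space X" and "Hausdorff_space X"
    and "open U"
    and "continuous_map (prod_topology X (top_of_set U)) euclidean f"
    and "\<And>x. x \<in> topspace X \<Longrightarrow> (\<lambda>y. f (x, y)) differentiable_on U"
    and "\<And>x y. x \<in> topspace X \<Longrightarrow> y \<in> U \<Longrightarrow> \<not> critical_point (\<lambda>y. f (x, y)) y"
    and "x\<^sub>0 \<in> topspace X" and "y\<^sub>0 \<in> U" and "z\<^sub>0 = f (x\<^sub>0, y\<^sub>0)"
  shows "\<exists>V g. openin X V \<and> x\<^sub>0 \<in> V \<and>
           continuous_map (subtopology X V) (top_of_set U) g \<and>
           (\<forall>x\<in>V. f (x, g x) = z\<^sub>0)"
proof -
  have diff: "(\<lambda>y. f (x, y)) differentiable at y" if "x \<in> topspace X" "y \<in> U" for x y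
    using assms(5)[OF that(1)] that(2) assms(3) by (metis at_within_open differentiable_on_def)
  have der: "\<exists>A. ((\<lambda>y. f (x, y)) has_derivative A) (at y) \<and> inj A" if "x \<in> topspace X" "y \<in> U" for x y
  proof (intro exI conjI)
    let ?J = "jacobian (\<lambda>y. f (x, y)) (at y)"
    show "((\<lambda>y. f (x, y)) has_derivative (*v) ?J) (at y)" using diff[OF that] jacobian_works by blast
    have "invertible ?J" using assms(6)[OF that] by (simp add: critical_point_def)
    then show "inj ((*v) ?J)" by (simp add: inj_matrix_vector_mult)
  qed
  have locinj: "\<exists>e>0. inj_on (\<lambda>y. f (x, y)) (ball y e)" if "x \<in> topspace X" "y \<in> U" for x y
    using locally_injective_if_injective_derivative[OF assms(3) der] that by blast
  have cont: "continuous_on U (\<lambda>y. f (x, y))" if "x \<in> topspace X" for x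
    using assms(5)[OF that] by (rule differentiable_imp_continuous_on)
  let ?h = "\<lambda>y. f (x\<^sub>0, y)"
  obtain e where e: "e > 0" "inj_on ?h (ball y\<^sub>0 e)" using locinj assms(7,8) by blast
  obtain e' where e': "e' > 0" "cball y\<^sub>0 e' \<subseteq> U" using assms(3,8) by (meson open_contains_cball)
  \<comment> \<open>Halving \<open>e\<close> puts the closed ball inside the open ball of
    injectivity.\<close>
  define r where "r = min (e/2) e'"
  have r: "r > 0" "cball y\<^sub>0 r \<subseteq> U" using e e' by (auto simp: r_def)
  have injh: "inj_on ?h (cball y\<^sub>0 r)" using e by (auto simp: r_def intro: inj_on_subset)
  have "open (?h ` ball y\<^sub>0 r)"
    using cont[OF assms(7)] r(2) injh ball_subset_cball[of y\<^sub>0 r]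
    by (intro invariance_of_domain) (blast intro: continuous_on_subset inj_on_subset open_ball)+
  moreover have "z\<^sub>0 \<in> ?h ` ball y\<^sub>0 r" using r assms(9) by auto
  ultimately obtain R where R: "R > 0" "ball z\<^sub>0 R \<subseteq> ?h ` ball y\<^sub>0 r" by (meson open_contains_ball)
  obtain V where V: "openin X V" "x\<^sub>0 \<in> V"
      "\<And>x y. x \<in> V \<Longrightarrow> y \<in> cball y\<^sub>0 r \<Longrightarrow> norm (f (x, y) - f (x\<^sub>0, y)) < R / 4"
    using eventually_uniformly_close_on_compact[OF assms(4) compact_cball r(2) assms(7), of "R/4"] R(1)
    by (metis zero_less_divide_iff zero_less_numeral)
  have VX: "x \<in> topspace X" if "x \<in> V" for x using V(1) that openin_subset by blast
  have contc: "continuous_on (cball y\<^sub>0 r) (\<lambda>y. f (x, y))" if "x \<in> topspace X" for x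
    using cont[OF that] r(2) continuous_on_subset by blast
  have ex1: "\<exists>!y. y \<in> cball y\<^sub>0 r \<and> f (x, y) = z\<^sub>0" if "x \<in> V" for x
    unfolding assms(9)
  proof (rule unique_preimage_perturbation[OF r(1) contc[OF assms(7)] injh contc[OF VX[OF that]]])
    show "\<exists>e>0. inj_on (\<lambda>y. f (x, y)) (ball y e)" if "y \<in> ball y\<^sub>0 r" for y
      using locinj[OF VX[OF \<open>x \<in> V\<close>]] that r(2) ball_subset_cball by blast
    show "ball (f (x\<^sub>0, y\<^sub>0)) (4 * (R / 4)) \<subseteq> ?h ` ball y\<^sub>0 r" using R(2) assms(9) by simp
  qed (use R(1) V(3)[OF that] in auto)
  define g where "g x = (THE y. y \<in> cball y\<^sub>0 r \<and> f (x, y) = z\<^sub>0)" for x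
  have g: "g x \<in> cball y\<^sub>0 r" "f (x, g x) = z\<^sub>0" if "x \<in> V" for x
    using theI'[OF ex1[OF that]] by (auto simp: g_def)
  have guniq: "y = g x" if "x \<in> V" "y \<in> cball y\<^sub>0 r" "f (x, y) = z\<^sub>0" for x y
    using ex1[OF that(1)] g[OF that(1)] that by blast
  have "continuous_map (subtopology X V) euclidean g"
    unfolding Met_TC.continuous_map_to_metric[unfolded mtopology_is_euclidean mball_eq_ball]
  proof (intro ballI allI impI)
    fix x and e :: real assume "x \<in> topspace (subtopology X V)" and "e > 0"
    then have x: "x \<in> V" by simp
    \<comment> \<open>On this compact set \<open>f (x, y)\<close> stays at distance at least some
      \<open>d > 0\<close> from \<open>z\<^sub>0\<close>, by uniqueness of \<open>g x\<close>. A
      parameter change that moves \<open>f\<close> by less than \<open>d\<close> on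
      \<open>?K\<close> creates no solution there, so the new solution lies in
      \<open>ball (g x) e\<close>.\<close>
    let ?K = "cball y\<^sub>0 r - ball (g x) e"
    have K: "compact ?K" "?K \<subseteq> U" using r by (auto intro: compact_diff)
    have "compact ((\<lambda>y. f (x, y)) ` ?K)"
      using K contc[OF VX[OF x]] by (meson Diff_subset compact_continuous_image continuous_on_subset)
    moreover have "z\<^sub>0 \<notin> (\<lambda>y. f (x, y)) ` ?K" using guniq[OF x] \<open>e > 0\<close> by fastforce
    ultimately obtain d where d: "d > 0" "\<And>y. y \<in> ?K \<Longrightarrow> d \<le> dist z\<^sub>0 (f (x, y))"
      using separate_point_closed[OF compact_imp_closed] by (metis imageI)
    obtain W where W: "openin X W" "x \<in> W" "\<And>x' y. x' \<in> W \<Longrightarrow> y \<in> ?K \<Longrightarrow> norm (f (x', y) - f (x, y)) < d"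
      using eventually_uniformly_close_on_compact[OF assms(4) K VX[OF x] d(1)] by metis
    have "g x' \<in> ball (g x) e" if "x' \<in> W \<inter> V" for x'
      using W(3)[of x' "g x'"] d(2)[of "g x'"] g[of x'] that by (force simp: dist_norm)
    then show "\<exists>T. openin (subtopology X V) T \<and> x \<in> T \<and> (\<forall>y\<in>T. g y \<in> ball (g x) e)"
      using W(1,2) x by (intro exI[of _ "W \<inter> V"]) (auto simp: openin_subtopology)
  qed
  then have "continuous_map (subtopology X V) (top_of_set U) g"
    using g(1) r(2) by (auto simp: continuous_map_in_subtopology)
  then show ?thesis using V(1,2) g(2) by blast
qed

end
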